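(* Let (Path) be the mixed-integer program defined in the context. It can be enhanced as follows. (i) The binary condition on the $x$-variables can be relaxed: replacing $x_j\in\{0,1\}$ by $0\le x_j\le 1$ for all $j\in V$ does not change the optimal value. (ii) The inequalities $d_i\ge\sum_{j:[i,j]\in E}(\ell_{[i,j]}-u_{[i,j]})z_{ij}$, $i\in V$, are valid for (Path), i.e. satisfied by every feasible solution of (Path). (iii) The constraints $d_i\ge d_j+\ell_{[i,j]}z_{ij}-\delta_{[i,j]}-R(1-z_{ij})$, $[i,j]\in E$, can be reinforced to $$d_i\ge d_j+\ell_{[i,j]}z_{ij}-\delta_{[i,j]}-R(1-z_{ij})+z_{ji}(R-\ell_{[i,j]})^+,\qquad [i,j]\in E,$$ where $a^+=\max\{a,0\}$: replacing the former by the latter does not change the optimal value of (Path).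
   Context: Setting. $N=(V,E,\ell)$ is an undirected network with $V=\{1,\dots,n\}$; each edge $e=[k,q]=[q,k]\in E$ is an unordered pair of distinct nodes with length $\ell_e>0$, maximal length reduction $u_e\in[0,\ell_e)$ and unit reduction cost $c_e\ge 0$. Given are a coverage radius $R>0$, a budget $B\ge 0$, a number of facilities $p\in\mathbb N$, and demands $w_i\ge 0$, $i\in V$. Standing assumptions: $\ell_e-u_e\le R$ and $c_eu_e\le B$ for all $e\in E$. (Path) has variables $x_j$ ($j\in V$), $z_{ij}$ and $z_{ji}$ for each $[i,j]\in E$, $d_i$ ($i\in V$), and $\delta_e=\delta_{[i,j]}$ ($e=[i,j]\in E$). Constraints indexed by $[i,j]\in E$ that are not symmetric in $i,j$ are imposed for both orderings $(i,j)$ and $(j,i)$. It reads: maximize $\sum_{i\in V}w_i\big(x_i+\sum_{j:[i,j]\in E}z_{ij}\big)$ subject to - $\sum_{j\in V}x_j=p$; - $\sum_{e\in E}c_e\delta_e\le B$; - $\sum_{j:[i,j]\in E}z_{ij}+x_i\le 1$ for $i\in V$; - $\sum_{j:[i,j]\in E,\,j\ne k}z_{ij}+x_i\ge z_{ki}$ for $[k,i]\in E$; - $0\le d_i\le R\sum_{j:[i,j]\in E}z_{ij}$ for $i\in V$; - $d_i\ge d_j+\ell_{[i,j]}z_{ij}-\delta_{[i,j]}-R(1-z_{ij})$ for $[i,j]\in E$; - $0\le\delta_e\le u_e(z_{ij}+z_{ji})$ for $e=[i,j]\in E$; - $x_j\in\{0,1\}$ for $j\in V$; $z_{ij}\in\{0,1\}$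 for $[i,j]\in E$. *)

theory Defs
  imports Complex_Main "HOL-Library.Extended_Real"
begin

text \<open>
  An edge joining i and j is the two-element set {i, j}, so edge data are automatically
  symmetric in the end nodes.
\<close>

record network =
  num_nodes :: nat
  edges :: "nat set set"
  len :: "nat set \<Rightarrow> real"
  max_red :: "nat set \<Rightarrow> real"
  red_cost :: "nat set \<Rightarrow> real"
  radius :: real
  budget :: real
  num_fac :: nat
  demand :: "nat \<Rightarrow> real"

definition nodes :: "network \<Rightarrow> nat set" where
  "nodes N = {1..num_nodes N}"

definition nbrs :: "network \<Rightarrow> nat \<Rightarrow> nat set" where
  "nbrs N i = {j. {i, j} \<in> edges N}"

definition valid_network :: "network \<Rightarrow> bool" where
  "valid_network N \<longleftrightarrow>
     (\<forall>e \<in> edges N. \<exists>i \<in> nodes N. \<exists>j \<in> nodes N. i \<noteq> j \<and> e = {i, j}) \<and>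
     (\<forall>e \<in> edges N. len N e > 0 \<and> 0 \<le> max_red N e \<and> max_red N e < len N e \<and> red_cost N e \<ge> 0) \<and>
     radius N > 0 \<and> budget N \<ge> 0 \<and>
     (\<forall>i \<in> nodes N. demand N i \<ge> 0) \<and>
     (\<forall>e \<in> edges N. len N e - max_red N e \<le> radius N) \<and>
     (\<forall>e \<in> edges N. red_cost N e * max_red N e \<le> budget N)"

text \<open>
  The variables of (Path).  Only the values at nodes, at ordered pairs (i, j) with
  {i, j} an edge, and at edges occur in the constraints and in the objective.
\<close>

record path_vars =
  xv :: "nat \<Rightarrow> real"
  zv :: "nat \<Rightarrow> nat \<Rightarrow> real"
  dv :: "nat \<Rightarrow> real"
  redv :: "nat set \<Rightarrow> real"

definition objective :: "network \<Rightarrow> path_vars \<Rightarrow> real" where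
  "objective N s = (\<Sum>i \<in> nodes N. demand N i * (xv s i + (\<Sum>j \<in> nbrs N i. zv s i j)))"

text \<open>
  All constraints of (Path) except the lower bounds on d along the edges and the domain of x.
  As the edge {i, j} equals {j, i}, quantifying over all i and j with {i, j} an edge imposes
  a constraint for both orderings.
\<close>

definition common_constraints :: "network \<Rightarrow> path_vars \<Rightarrow> bool" where
  "common_constraints N s \<longleftrightarrow>
     (\<Sum>j \<in> nodes N. xv s j) = real (num_fac N) \<and>
     (\<Sum>e \<in> edges N. red_cost N e * redv s e) \<le> budget N \<and>
     (\<forall>i \<in> nodes N. (\<Sum>j \<in> nbrs N i. zv s i j) + xv s i \<le> 1) \<and>
     (\<forall>k i. {k, i} \<in> edges N \<longrightarrow> (\<Sum>j \<in> nbrs N i - {k}. zv s i j) + xv s i \<ge> zv s k i) \<and>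
     (\<forall>i \<in> nodes N. 0 \<le> dv s i \<and> dv s i \<le> radius N * (\<Sum>j \<in> nbrs N i. zv s i j)) \<and>
     (\<forall>i j. {i, j} \<in> edges N \<longrightarrow>
        0 \<le> redv s {i, j} \<and> redv s {i, j} \<le> max_red N {i, j} * (zv s i j + zv s j i)) \<and>
     (\<forall>i j. {i, j} \<in> edges N \<longrightarrow> zv s i j \<in> {0, 1})"

definition dist_constraints :: "network \<Rightarrow> path_vars \<Rightarrow> bool" where
  "dist_constraints N s \<longleftrightarrow>
     (\<forall>i j. {i, j} \<in> edges N \<longrightarrow>
        dv s i \<ge> dv s j + len N {i, j} * zv s i j - redv s {i, j} - radius N * (1 - zv s i j))"

definition reinforced_dist_constraints :: "network \<Rightarrow> path_vars \<Rightarrow> bool" where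
  "reinforced_dist_constraints N s \<longleftrightarrow>
     (\<forall>i j. {i, j} \<in> edges N \<longrightarrow>
        dv s i \<ge> dv s j + len N {i, j} * zv s i j - redv s {i, j} - radius N * (1 - zv s i j)
                 + zv s j i * max (radius N - len N {i, j}) 0)"

definition binary_x :: "network \<Rightarrow> path_vars \<Rightarrow> bool" where
  "binary_x N s \<longleftrightarrow> (\<forall>j \<in> nodes N. xv s j \<in> {0, 1})"

definition relaxed_x :: "network \<Rightarrow> path_vars \<Rightarrow> bool" where
  "relaxed_x N s \<longleftrightarrow> (\<forall>j \<in> nodes N. 0 \<le> xv s j \<and> xv s j \<le> 1)"

definition Path :: "network \<Rightarrow> path_vars set" where
  "Path N = {s. common_constraints N s \<and> dist_constraints N s \<and> binary_x N s}"

definition Path_relaxed :: "network \<Rightarrow> path_vars set" where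
  "Path_relaxed N = {s. common_constraints N s \<and> dist_constraints N s \<and> relaxed_x N s}"

definition Path_reinforced :: "network \<Rightarrow> path_vars set" where
  "Path_reinforced N = {s. common_constraints N s \<and> reinforced_dist_constraints N s \<and> binary_x N s}"

text \<open>The optimal value of an infeasible program is minus infinity, as usual for maximization.\<close>

definition opt_value :: "network \<Rightarrow> path_vars set \<Rightarrow> ereal" where
  "opt_value N F = (SUP s \<in> F. ereal (objective N s))"

end

theory Submission
  imports Defs
begin

text \<open>
  A feasible solution is a forest of arcs: node \<open>i\<close> points to \<open>j\<close> when \<open>z i j = 1\<close>.  The covering
  constraint gives each node at most one outgoing arc and makes \<open>x i\<close> vanish if there is one; the
  linking constraint forces an open facility, or an outgoing arc to a third node, at the head of
  every arc.  Together they exclude antiparallel arcs, so the reduction of an edge is at most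
  \<open>max_red\<close> instead of twice that amount.  This gives the inequalities of part (ii).

  For part (i), a node with fractional \<open>x\<close> touches no arc at all: an outgoing one would force
  \<open>x = 0\<close>, an incoming one \<open>x = 1\<close>.  Such nodes are therefore tied together only by the cardinality
  constraint, and their values of \<open>x\<close> have an integral sum \<open>m\<close>; opening the \<open>m\<close> of them with the
  largest demands is feasible and does not decrease the objective
  (\<open>integral_selection_dominates\<close>).

  For part (iii), the reinforcement is an upper bound on \<open>d\<close> in disguise: if \<open>j\<close> points to \<open>i\<close>, it
  says that \<open>d j\<close> exceeds \<open>d i\<close> by at most \<open>\<ell> + \<delta>\<close> when \<open>\<ell> \<le> R\<close>.  As \<open>d\<close> does not occur in the
  objective, it may be replaced by the smallest labels compatible with the arcs
  (\<open>tight_labels_exist\<close>), and for those \<open>d j = d i + \<ell> - \<delta>\<close>.  Where there is no arc, the distance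
  constraint holds because all labels lie between \<open>0\<close> and \<open>R\<close>.
\<close>

section \<open>Comparing optimal values\<close>

lemma opt_value_mono:
  assumes "\<And>s. s \<in> F \<Longrightarrow> \<exists>t\<in>G. objective N s \<le> objective N t"
  shows "opt_value N F \<le> opt_value N G"
  unfolding opt_value_def using assms by (intro SUP_mono) auto

section \<open>Selecting the heaviest elements\<close>

text \<open>
  Choose \<open>T\<close> as a heaviest \<open>m\<close>-element subset.  By exchange, some threshold \<open>t\<close> separates the weights
  inside \<open>T\<close> from those outside.  Passing from \<open>x\<close> to the indicator of \<open>T\<close> adds the mass \<open>1 - x\<close>
  at weights of at least \<open>t\<close> and removes the same total mass at weights of at most \<open>t\<close>.
\<close>
lemma integral_selection_dominates:
  fixes w x :: "'a \<Rightarrow> real"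
  assumes fin: "finite A"
    and x0: "\<And>i. i \<in> A \<Longrightarrow> 0 \<le> x i" and x1: "\<And>i. i \<in> A \<Longrightarrow> x i \<le> 1"
    and sx: "sum x A = real m"
  obtains T where "T \<subseteq> A" "card T = m" "(\<Sum>i\<in>A. w i * x i) \<le> sum w T"
proof (cases "m = 0")
  case True
  then have "\<forall>i\<in>A. x i = 0"
    using sum_nonneg_eq_0_iff[OF fin, of x] x0 sx by simp
  then show thesis using that[of "{}"] True by simp
next
  case False
  have "sum x A \<le> (\<Sum>i\<in>A. 1)" by (intro sum_mono) (rule x1)
  then have "m \<le> card A" using sx by simp
  let ?C = "{T. T \<subseteq> A \<and> card T = m}"
  have finC: "finite ?C" using fin by simp
  have "?C \<noteq> {}" using obtain_subset_with_card_n[OF \<open>m \<le> card A\<close>] by blast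
  then have "Max (sum w ` ?C) \<in> sum w ` ?C" using finC by (intro Max_in) auto
  then obtain T where heaviest: "Max (sum w ` ?C) = sum w T" and T: "T \<in> ?C" by (rule imageE)
  have best: "sum w U \<le> sum w T" if "U \<in> ?C" for U
    unfolding heaviest[symmetric] using finC that by (intro Max_ge finite_imageI imageI)
  have TA: "T \<subseteq> A" and cT: "card T = m" using T by auto
  have finT: "finite T" using TA fin finite_subset by blast
  have exch: "w b \<le> w a" if "a \<in> T" "b \<in> A - T" for a b
  proof -
    have "insert b (T - {a}) \<in> ?C"
      using that TA cT finT False by (auto simp: card_insert_if card_Diff_singleton)
    then have "sum w (insert b (T - {a})) \<le> sum w T" by (rule best)
    moreover have "sum w (insert b (T - {a})) = w b + sum w T - w a"
      using that finT by (simp add: sum_diff1)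
    ultimately show ?thesis by simp
  qed
  have "T \<noteq> {}" using cT False by auto
  define t where "t = Min (w ` T)"
  have tT: "t \<le> w i" if "i \<in> T" for i
    unfolding t_def using finT that by simp
  have "t \<in> w ` T" unfolding t_def using finT \<open>T \<noteq> {}\<close> by (intro Min_in) auto
  then obtain a where "t = w a" "a \<in> T" by (rule imageE)
  then have tO: "w i \<le> t" if "i \<in> A - T" for i using exch that by simp
  have split: "sum f A = sum f (A - T) + sum f T" for f :: "'a \<Rightarrow> real"
    using sum.subset_diff[OF TA fin] .
  have "(\<Sum>i\<in>A - T. w i * x i) \<le> (\<Sum>i\<in>A - T. t * x i)"
    by (intro sum_mono mult_right_mono) (use tO x0 in auto)
  moreover have "(\<Sum>i\<in>T. t * (1 - x i)) \<le> (\<Sum>i\<in>T. w i * (1 - x i))"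
    by (intro sum_mono mult_right_mono) (use tT x1 TA in auto)
  moreover have "(\<Sum>i\<in>A - T. t * x i) = (\<Sum>i\<in>T. t * (1 - x i))"
  proof -
    have "sum x (A - T) = real (card T) - sum x T" using split[of x] sx cT by simp
    also have "\<dots> = (\<Sum>i\<in>T. 1 - x i)" by (simp add: sum_subtractf)
    finally show ?thesis by (simp add: sum_distrib_left[symmetric])
  qed
  moreover have "(\<Sum>i\<in>T. w i * (1 - x i)) = sum w T - (\<Sum>i\<in>T. w i * x i)"
    by (simp add: right_diff_distrib sum_subtractf)
  ultimately have "(\<Sum>i\<in>A. w i * x i) \<le> sum w T"
    using split[of "\<lambda>i. w i * x i"] by linarith
  then show thesis using that TA cT by blast
qed

section \<open>Smallest labels along a partial function\<close>

text \<open>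
  The pointwise infimum of all nonnegative labellings that satisfy the inequalities satisfies them
  again.  If one of them were slack, lowering the label of its tail would give a smaller labelling,
  because apart from nonnegativity, which \<open>c \<ge> 0\<close> preserves, nothing else bounds that label from
  below.
\<close>
lemma tight_labels_exist:
  fixes A :: "'a \<Rightarrow> 'a \<Rightarrow> bool" and c :: "'a \<Rightarrow> 'a \<Rightarrow> real" and d :: "'a \<Rightarrow> real"
  assumes single: "\<And>i j k. A i j \<Longrightarrow> A i k \<Longrightarrow> j = k"
    and irrefl: "\<And>i. \<not> A i i"
    and c0: "\<And>i j. A i j \<Longrightarrow> 0 \<le> c i j"
    and d0: "\<And>i. 0 \<le> d i"
    and dA: "\<And>i j. A i j \<Longrightarrow> d j + c i j \<le> d i"
  obtains e where "\<And>i. 0 \<le> e i" "\<And>i. e i \<le> d i" "\<And>i j. A i j \<Longrightarrow> e i = e j + c i j"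
proof -
  define D where "D = {f. (\<forall>i. 0 \<le> f i) \<and> (\<forall>i j. A i j \<longrightarrow> f j + c i j \<le> f i)}"
  define e where "e i = (INF f\<in>D. f i)" for i
  have dD: "d \<in> D" using d0 dA by (auto simp: D_def)
  have bdd: "bdd_below ((\<lambda>f. f i) ` D)" for i
    by (rule bdd_belowI[of _ 0]) (auto simp: D_def)
  have lower: "e i \<le> f i" if "f \<in> D" for f i
    unfolding e_def using bdd that by (rule cINF_lower)
  have greatest: "b \<le> e i" if "\<And>f. f \<in> D \<Longrightarrow> b \<le> f i" for b i
    unfolding e_def using dD that by (intro cINF_greatest) auto
  have e0: "0 \<le> e i" for i by (rule greatest) (auto simp: D_def)
  have eA: "e j + c i j \<le> e i" if "A i j" for i j
  proof (rule greatest)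
    fix f assume "f \<in> D"
    then have "f j + c i j \<le> f i" using that by (auto simp: D_def)
    then show "e j + c i j \<le> f i" using lower[OF \<open>f \<in> D\<close>, of j] by simp
  qed
  have "e i \<le> e j + c i j" if "A i j" for i j
  proof -
    let ?f = "e(i := e j + c i j)"
    have le: "?f k \<le> e k" for k using eA[OF that] by simp
    have "?f l + c k l \<le> ?f k" if "A k l" for k l
    proof (cases "k = i")
      case True
      then have "l = j" using single that \<open>A i j\<close> by blast
      moreover have "j \<noteq> i" using irrefl \<open>A i j\<close> by blast
      ultimately show ?thesis using True by simp
    next
      case False
      then show ?thesis using eA[OF that] le[of l] by simp
    qed
    then have "?f \<in> D" using e0 c0[OF that] by (auto simp: D_def)
    from lower[OF this, of i] show ?thesis by simp
  qed
  with eA show thesis using that[of e] e0 lower[OF dD] by (meson order_antisym)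
qed

section \<open>Arcs of a feasible solution\<close>

context
  fixes N :: network
  assumes valid: "valid_network N"
begin

lemma edge_ends:
  assumes "{i, j} \<in> edges N"
  shows "i \<in> nodes N" "j \<in> nodes N" "i \<noteq> j"
  using assms valid unfolding valid_network_def by (metis doubleton_eq_iff)+

lemma finite_nodes: "finite (nodes N)"
  by (simp add: nodes_def)

lemma finite_nbrs: "finite (nbrs N i)"
  by (rule finite_subset[OF _ finite_nodes]) (auto simp: nbrs_def dest: edge_ends)

lemma edge_data:
  assumes "e \<in> edges N"
  shows "0 < len N e" "0 \<le> max_red N e" "max_red N e < len N e"
  using assms valid by (auto simp: valid_network_def)

context
  fixes s :: path_vars
  assumes feas: "common_constraints N s"
begin

lemma z_binary: "{i, j} \<in> edges N \<Longrightarrow> zv s i j = 0 \<or> zv s i j = 1"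
  using feas by (auto simp: common_constraints_def)

lemma z_nonneg: "j \<in> nbrs N i \<Longrightarrow> 0 \<le> zv s i j"
  using z_binary by (fastforce simp: nbrs_def)

lemma out_degree:
  assumes "i \<in> nodes N"
  shows "(\<Sum>j \<in> nbrs N i. zv s i j) + xv s i \<le> 1"
  using feas assms by (auto simp: common_constraints_def)

lemma z_le_out_degree:
  assumes "{i, j} \<in> edges N"
  shows "zv s i j \<le> (\<Sum>j \<in> nbrs N i. zv s i j)"
  using assms by (intro member_le_sum finite_nbrs z_nonneg) (auto simp: nbrs_def)

text \<open>
  The sum that must cover \<open>z j i\<close> in the linking constraint omits \<open>z i j\<close>, so both values fit
  side by side under the covering constraint of \<open>i\<close>.
\<close>
lemma no_antiparallel_arcs:
  assumes "{i, j} \<in> edges N"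
  shows "zv s i j + zv s j i \<le> 1"
proof -
  have "j \<in> nbrs N i" and ji: "{j, i} \<in> edges N"
    using assms by (auto simp: nbrs_def insert_commute)
  then have "(\<Sum>k \<in> nbrs N i. zv s i k) = zv s i j + (\<Sum>k \<in> nbrs N i - {j}. zv s i k)"
    by (intro sum.remove finite_nbrs)
  moreover have "zv s j i \<le> (\<Sum>k \<in> nbrs N i - {j}. zv s i k) + xv s i"
    using feas ji by (auto simp: common_constraints_def)
  ultimately show ?thesis
    using out_degree[OF edge_ends(1)[OF assms]] by linarith
qed

lemma reduction_bounds:
  assumes "{i, j} \<in> edges N"
  shows "0 \<le> redv s {i, j}" "redv s {i, j} \<le> max_red N {i, j}"
proof -
  show "0 \<le> redv s {i, j}" using feas assms by (auto simp: common_constraints_def)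
  have "redv s {i, j} \<le> max_red N {i, j} * (zv s i j + zv s j i)"
    using feas assms by (auto simp: common_constraints_def)
  also have "\<dots> \<le> max_red N {i, j} * 1"
    using no_antiparallel_arcs[OF assms] edge_data(2)[OF assms] by (rule mult_left_mono)
  finally show "redv s {i, j} \<le> max_red N {i, j}" by simp
qed

lemma d_bounds:
  assumes "i \<in> nodes N"
  shows "0 \<le> dv s i" "dv s i \<le> radius N * (\<Sum>j \<in> nbrs N i. zv s i j)"
  using feas assms by (auto simp: common_constraints_def)

lemma out_arc_unique:
  assumes x0: "0 \<le> xv s i" and j: "{i, j} \<in> edges N" "zv s i j = 1"
    and k: "{i, k} \<in> edges N" "zv s i k = 1"
  shows "j = k"
proof (rule ccontr)
  assume "j \<noteq> k"
  then have "2 = (\<Sum>l\<in>{j, k}. zv s i l)" using j k by simp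
  also have "\<dots> \<le> (\<Sum>l \<in> nbrs N i. zv s i l)"
    using j k by (intro sum_mono2 finite_nbrs) (auto simp: nbrs_def z_nonneg)
  finally show False using out_degree[OF edge_ends(1)[OF j(1)]] x0 by linarith
qed

lemma out_arcs_sum_single:
  assumes "0 \<le> xv s i" and j: "{i, j} \<in> edges N" "zv s i j = 1"
  shows "(\<Sum>k \<in> nbrs N i. f k * zv s i k) = f j"
proof -
  have "j \<in> nbrs N i" using j by (simp add: nbrs_def)
  moreover have "zv s i k = 0" if "k \<in> nbrs N i - {j}" for k
    using that out_arc_unique[OF assms, of k] z_binary[of i k] by (auto simp: nbrs_def)
  ultimately show ?thesis
    using j by (subst sum.remove[OF finite_nbrs]) auto
qed

section \<open>Rounding fractional facilities\<close>

lemma fractional_facility_isolated: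
  assumes i: "i \<in> nodes N" and frac: "0 < xv s i" "xv s i < 1" and e: "{i, k} \<in> edges N"
  shows "zv s i k = 0" "zv s k i = 0"
proof -
  have no_out: "zv s i j = 0" if "j \<in> nbrs N i" for j
    using that z_binary[of i j] z_le_out_degree[of i j] out_degree[OF i] frac
    by (auto simp: nbrs_def)
  then show "zv s i k = 0" using e by (simp add: nbrs_def)
  have ki: "{k, i} \<in> edges N" using e by (simp add: insert_commute)
  have "zv s k i \<le> (\<Sum>j \<in> nbrs N i - {k}. zv s i j) + xv s i"
    using feas ki by (auto simp: common_constraints_def)
  also have "\<dots> = xv s i" using no_out by simp
  finally show "zv s k i = 0" using frac z_binary[OF ki] by linarith
qed

text \<open>Fractional nodes share what \<open>num_fac N\<close> leaves after the fully open facilities.\<close>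
lemma fractional_mass_integral:
  assumes "relaxed_x N s"
  obtains m where "(\<Sum>i | i \<in> nodes N \<and> 0 < xv s i \<and> xv s i < 1. xv s i) = real m"
proof -
  let ?F = "{i \<in> nodes N. 0 < xv s i \<and> xv s i < 1}"
  let ?O = "{i \<in> nodes N. xv s i = 1}"
  have "real (num_fac N) = (\<Sum>i \<in> nodes N. xv s i)"
    using feas by (auto simp: common_constraints_def)
  also have "\<dots> = (\<Sum>i \<in> ?F \<union> ?O. xv s i)"
    using assms finite_nodes by (intro sum.mono_neutral_right) (auto simp: relaxed_x_def less_le)
  also have "\<dots> = sum (xv s) ?F + sum (xv s) ?O"
    using finite_nodes by (intro sum.union_disjoint) auto
  also have "sum (xv s) ?O = real (card ?O)" by simp
  finally have eq: "sum (xv s) ?F = real (num_fac N) - real (card ?O)" by simp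
  moreover have "0 \<le> sum (xv s) ?F" by (intro sum_nonneg) auto
  ultimately have "sum (xv s) ?F = real (num_fac N - card ?O)" by (simp add: of_nat_diff)
  then show thesis by (rule that)
qed

lemma integral_facilities_dominate:
  assumes dist: "dist_constraints N s" and relaxed: "relaxed_x N s"
  shows "\<exists>t \<in> Path N. objective N s \<le> objective N t"
proof -
  let ?F = "{i \<in> nodes N. 0 < xv s i \<and> xv s i < 1}"
  obtain m where mass: "sum (xv s) ?F = real m" using fractional_mass_integral[OF relaxed] .
  obtain T where T: "T \<subseteq> ?F" "card T = m"
    and gain: "(\<Sum>i\<in>?F. demand N i * xv s i) \<le> sum (demand N) T"
    by (rule integral_selection_dominates[of ?F "xv s" m "demand N"]) (use finite_nodes mass in auto)
  define x where "x i = (if i \<in> ?F then of_bool (i \<in> T) else xv s i)" for i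
  define t where "t = s\<lparr>xv := x\<rparr>"
  have t_sel: "xv t = x" "zv t = zv s" "dv t = dv s" "redv t = redv s" by (simp_all add: t_def)
  have split: "sum f (nodes N) = sum f (nodes N - ?F) + sum f ?F" for f :: "nat \<Rightarrow> real"
    using finite_nodes by (intro sum.subset_diff) auto
  have on_F: "(\<Sum>i\<in>?F. g i * x i) = sum g T" for g :: "nat \<Rightarrow> real"
  proof -
    have "(\<Sum>i\<in>?F. g i * x i) = (\<Sum>i\<in>T. g i * x i)"
      using T finite_nodes by (intro sum.mono_neutral_right) (auto simp: x_def)
    also have "\<dots> = sum g T" using T by (intro sum.cong) (auto simp: x_def)
    finally show ?thesis .
  qed
  have off_F: "(\<Sum>i\<in>nodes N - ?F. g i * x i) = (\<Sum>i\<in>nodes N - ?F. g i * xv s i)"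
    for g :: "nat \<Rightarrow> real"
    by (intro sum.cong) (auto simp: x_def)
  have total: "sum x (nodes N) = sum (xv s) (nodes N)"
    using split[of x] split[of "xv s"] on_F[of "\<lambda>_. 1"] off_F[of "\<lambda>_. 1"] T mass by simp
  have cover: "(\<Sum>j \<in> nbrs N i. zv s i j) + x i \<le> 1" if "i \<in> nodes N" for i
  proof (cases "i \<in> ?F")
    case True
    then have "(\<Sum>j \<in> nbrs N i. zv s i j) = 0"
      using fractional_facility_isolated(1)[of i] by (intro sum.neutral) (auto simp: nbrs_def)
    then show ?thesis using True by (simp add: x_def)
  next
    case False
    then have "x i = xv s i" unfolding x_def by (rule if_not_P)
    then show ?thesis using out_degree[OF that] by simp
  qed
  have link: "zv s k i \<le> (\<Sum>j \<in> nbrs N i - {k}. zv s i j) + x i" if e: "{k, i} \<in> edges N" for k i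
  proof (cases "i \<in> ?F")
    case True
    then have "zv s k i = 0"
      using fractional_facility_isolated(2)[of i k] e by (simp add: insert_commute)
    moreover have "0 \<le> (\<Sum>j \<in> nbrs N i - {k}. zv s i j)" by (intro sum_nonneg) (auto intro: z_nonneg)
    ultimately show ?thesis using True by (simp add: x_def)
  next
    case False
    then show ?thesis using feas e by (auto simp: common_constraints_def x_def)
  qed
  have "common_constraints N t"
    using feas total cover link unfolding common_constraints_def t_sel by auto
  moreover have "dist_constraints N t" using dist unfolding dist_constraints_def t_sel .
  moreover have "binary_x N t"
    using relaxed unfolding binary_x_def relaxed_x_def t_sel x_def by (auto simp: less_le)
  moreover have "objective N s \<le> objective N t"
  proof -
    have "(\<Sum>i\<in>nodes N. demand N i * xv s i) \<le> (\<Sum>i\<in>nodes N. demand N i * x i)"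
      using gain split[of "\<lambda>i. demand N i * xv s i"] split[of "\<lambda>i. demand N i * x i"]
        on_F[of "demand N"] off_F[of "demand N"] by simp
    then show ?thesis unfolding objective_def t_sel by (simp add: distrib_left sum.distrib)
  qed
  ultimately show ?thesis by (auto simp: Path_def)
qed

section \<open>Distance labels\<close>

lemma d_along_arc:
  assumes "dist_constraints N s" and "{i, j} \<in> edges N" and "zv s i j = 1"
  shows "dv s j + (len N {i, j} - redv s {i, j}) \<le> dv s i"
proof -
  have "dv s i \<ge> dv s j + len N {i, j} * zv s i j - redv s {i, j} - radius N * (1 - zv s i j)"
    using assms(1,2) unfolding dist_constraints_def by blast
  then show ?thesis using assms(3) by simp
qed

lemma d_lower_bound:
  assumes dist: "dist_constraints N s" and x0: "0 \<le> xv s i" and i: "i \<in> nodes N"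
  shows "(\<Sum>j \<in> nbrs N i. (len N {i, j} - max_red N {i, j}) * zv s i j) \<le> dv s i"
proof (cases "\<exists>j. {i, j} \<in> edges N \<and> zv s i j = 1")
  case True
  then obtain j where j: "{i, j} \<in> edges N" "zv s i j = 1" by blast
  show ?thesis
    using out_arcs_sum_single[OF x0 j] d_along_arc[OF dist j] reduction_bounds[OF j(1)]
      d_bounds(1)[OF edge_ends(2)[OF j(1)]] by simp
next
  case False
  then have "(\<Sum>j \<in> nbrs N i. (len N {i, j} - max_red N {i, j}) * zv s i j) = 0"
    using z_binary by (intro sum.neutral) (auto simp: nbrs_def)
  then show ?thesis using d_bounds(1)[OF i] by simp
qed

text \<open>
  With tight labels, \<open>z j i = 1\<close> gives \<open>d j = d i + \<ell> - \<delta>\<close>, which is stronger than the bound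
  \<open>d j \<le> d i + \<ell> + \<delta>\<close> that the reinforced constraint for \<open>(i, j)\<close> imposes if \<open>\<ell> \<le> R\<close>.
  If \<open>\<ell> > R\<close> or \<open>z j i = 0\<close>, the reinforcement vanishes, and the constraint for \<open>(i, j)\<close> is either
  the tight one or, if \<open>z i j = 0\<close>, implied by \<open>d j \<le> R\<close> and \<open>d i \<ge> 0\<close>.
\<close>
lemma tight_distances_reinforced:
  assumes dist: "dist_constraints N s" and binary: "binary_x N s"
  shows "\<exists>t \<in> Path_reinforced N. objective N s \<le> objective N t"
proof -
  have x0: "0 \<le> xv s i" if "i \<in> nodes N" for i
    using binary that by (fastforce simp: binary_x_def)
  define A where "A i j \<longleftrightarrow> {i, j} \<in> edges N \<and> zv s i j = 1" for i j
  \<comment> \<open>Off the nodes \<open>dv s\<close> is unconstrained, so it is cut off there to be nonnegative everywhere.\<close>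
  define d where "d i = (if i \<in> nodes N then dv s i else 0)" for i
  obtain e where e0: "\<And>i. 0 \<le> e i" and ed: "\<And>i. e i \<le> d i"
    and tight: "\<And>i j. A i j \<Longrightarrow> e i = e j + (len N {i, j} - redv s {i, j})"
  proof (rule tight_labels_exist[of A "\<lambda>i j. len N {i, j} - redv s {i, j}" d])
    show "j = k" if "A i j" "A i k" for i j k
      using that out_arc_unique[of i j k] x0 edge_ends(1) by (auto simp: A_def)
    show "\<not> A i i" for i using edge_ends(3)[of i i] by (auto simp: A_def)
    show "0 \<le> len N {i, j} - redv s {i, j}" if "A i j" for i j
      using that reduction_bounds(2)[of i j] edge_data(3)[of "{i, j}"] by (simp add: A_def)
    show "0 \<le> d i" for i using d_bounds(1) by (simp add: d_def)
    show "d j + (len N {i, j} - redv s {i, j}) \<le> d i" if "A i j" for i j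
      using that d_along_arc[OF dist] edge_ends[of i j] by (simp add: A_def d_def)
  qed blast
  have eR: "e i \<le> radius N * (\<Sum>j \<in> nbrs N i. zv s i j)" if "i \<in> nodes N" for i
    using ed[of i] d_bounds(2)[OF that] that by (simp add: d_def)
  have R: "e i \<le> radius N" if "i \<in> nodes N" for i
  proof -
    have "radius N * (\<Sum>j \<in> nbrs N i. zv s i j) \<le> radius N * 1"
      using out_degree[OF that] x0[OF that] valid
      by (intro mult_left_mono) (auto simp: valid_network_def)
    then show ?thesis using eR[OF that] by simp
  qed
  define t where "t = s\<lparr>dv := e\<rparr>"
  have t_sel: "xv t = xv s" "zv t = zv s" "dv t = e" "redv t = redv s" by (simp_all add: t_def)
  have "common_constraints N t"
    using feas e0 eR unfolding common_constraints_def t_sel by auto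
  moreover have "binary_x N t" using binary unfolding binary_x_def t_sel .
  moreover have "reinforced_dist_constraints N t"
    unfolding reinforced_dist_constraints_def t_sel
  proof (intro allI impI)
    fix i j assume ij: "{i, j} \<in> edges N"
    then have ji: "{j, i} \<in> edges N" by (simp add: insert_commute)
    note red0 = reduction_bounds(1)[OF ij] and Rj = R[OF edge_ends(2)[OF ij]]
    consider "zv s i j = 1" "zv s j i = 0" | "zv s i j = 0" "zv s j i = 1"
      | "zv s i j = 0" "zv s j i = 0"
      using z_binary[OF ij] z_binary[OF ji] no_antiparallel_arcs[OF ij] by fastforce
    then show "e j + len N {i, j} * zv s i j - redv s {i, j} - radius N * (1 - zv s i j)
        + zv s j i * max (radius N - len N {i, j}) 0 \<le> e i"
    proof cases
      case 1
      then show ?thesis using tight[of i j] ij by (simp add: A_def)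
    next
      case 2
      then have "e j = e i + (len N {i, j} - redv s {i, j})"
        using tight[of j i] ji by (simp add: A_def insert_commute)
      then show ?thesis using 2 red0 Rj e0[of i] by (simp add: max_def)
    next
      case 3
      then show ?thesis using red0 Rj e0[of i] by simp
    qed
  qed
  moreover have "objective N s = objective N t" unfolding objective_def t_sel ..
  ultimately show ?thesis by (auto simp: Path_reinforced_def)
qed

end

lemma Path_reinforced_subset: "Path_reinforced N \<subseteq> Path N"
proof
  fix s assume s: "s \<in> Path_reinforced N"
  then have feas: "common_constraints N s" by (simp add: Path_reinforced_def)
  have "dv s j + len N {i, j} * zv s i j - redv s {i, j} - radius N * (1 - zv s i j) \<le> dv s i"
    if "{i, j} \<in> edges N" for i j
  proof -
    have "0 \<le> zv s j i * max (radius N - len N {i, j}) 0"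
      using z_binary[OF feas, of j i] that by (auto simp: insert_commute)
    moreover have "dv s i \<ge> dv s j + len N {i, j} * zv s i j - redv s {i, j}
        - radius N * (1 - zv s i j) + zv s j i * max (radius N - len N {i, j}) 0"
      using s that unfolding Path_reinforced_def reinforced_dist_constraints_def by blast
    ultimately show ?thesis by linarith
  qed
  then show "s \<in> Path N"
    using s by (auto simp: Path_def Path_reinforced_def dist_constraints_def)
qed

end

lemma Path_subset_relaxed: "Path N \<subseteq> Path_relaxed N"
  by (force simp: Path_def Path_relaxed_def binary_x_def relaxed_x_def)

theorem proposition4:
  fixes N :: network
  assumes "valid_network N"
  shows "opt_value N (Path_relaxed N) = opt_value N (Path N) \<and>
         (\<forall>s \<in> Path N. \<forall>i \<in> nodes N.
            dv s i \<ge> (\<Sum>j \<in> nbrs N i. (len N {i, j} - max_red N {i, j}) * zv s i j)) \<and>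
         opt_value N (Path_reinforced N) = opt_value N (Path N)"
proof (intro conjI ballI)
  show "opt_value N (Path_relaxed N) = opt_value N (Path N)"
  proof (rule antisym)
    show "opt_value N (Path_relaxed N) \<le> opt_value N (Path N)"
      by (rule opt_value_mono)
        (auto simp: Path_relaxed_def intro: integral_facilities_dominate[OF assms])
    show "opt_value N (Path N) \<le> opt_value N (Path_relaxed N)"
      by (rule opt_value_mono) (use Path_subset_relaxed in blast)
  qed
next
  fix s i assume s: "s \<in> Path N" and i: "i \<in> nodes N"
  then have "0 \<le> xv s i" by (fastforce simp: Path_def binary_x_def)
  then show "(\<Sum>j \<in> nbrs N i. (len N {i, j} - max_red N {i, j}) * zv s i j) \<le> dv s i"
    using s i d_lower_bound[OF assms] by (auto simp: Path_def)
next
  show "opt_value N (Path_reinforced N) = opt_value N (Path N)"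
  proof (rule antisym)
    show "opt_value N (Path_reinforced N) \<le> opt_value N (Path N)"
      by (rule opt_value_mono) (use Path_reinforced_subset[OF assms] in blast)
    show "opt_value N (Path N) \<le> opt_value N (Path_reinforced N)"
      by (rule opt_value_mono)
        (auto simp: Path_def intro: tight_distances_reinforced[OF assms])
  qed
qed

end
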